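(* Let $C$ be a $QU$-chain group on a finite set $E$, and let $F\subseteq E$. Then $$\delta(P_C[F,F])=\frac{|\{B\subseteq E: B \text{ a basis of } M(C),\ F\subseteq B\}|}{|\{B\subseteq E: B\text{ a basis of } M(C)\}|}.$$
   Context: $\mathbb{H}$ is the skew field of quaternions; for $p=a+bi+cj+dk$, $\bar p=a-bi-cj-dk$ and $|p|=\sqrt{a^2+b^2+c^2+d^2}$. $S\mathbb{H}=\{p:|p|=1\}$, $QU:=(\mathbb{H},S\mathbb{H})$. An $\mathbb{H}$-chain group on $E$ is a subset of $\mathbb{H}^E$ containing $0$ and closed under componentwise addition and left scalar multiplication. A chain $c$ is elementary in $C$ if $c\ne0$ and no nonzero chain of $C$ has support strictly contained in $\|c\|=\{e:c_e\ne0\}$; $c$ is $S\mathbb{H}$-primitive if its entries lie in $S\mathbb{H}\cup\{0\}$. A $QU$-chain group is an $\mathbb{H}$-chain group in which every elementary chain equals $rc'$ with $r\in\mathbb{H}$, $c'$ an $S\mathbb{H}$-primitive chain of the group; $M(C)$ is the matroid on $E$ whose cocircuits are supports of elementary chains. $A^\dagger$ is the conjugate transpose of a quaternion matrix $A$. The projection matrix $P_C$ is the $E\times E$ matrix $A^\dagger(AA^\dagger)^{-1}A$, where $A$ is any matrix of full row rank over $\mathbb{H}$ with $\{zA: z \text{ a row vector}\}=C$; it depends only on $C$. $P_C[F,F]$ is its principal submatrix on $F$. With $\phi(a+bi+cj+dk)=\begin{bmatrix}a+bi&c+di\\-c+di&a-bi\end{bmatrix}$ applied entrywise and $z_2$ replacing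 each $2\times2$ complex entry by its block, $\delta(D):=\sqrt{|\det(z_2(\phi(D)))|}$ for square quaternion matrices $D$, with $\delta$ of the empty matrix equal to $1$. *)

theory Defs
  imports "HOL-Analysis.Analysis"
begin

section \<open>Quaternions\<close>

text \<open>\<open>Quat a b c d\<close> stands for \<open>a + bi + cj + dk\<close>.\<close>

datatype quat = Quat (qre: real) (qi: real) (qj: real) (qk: real)

lemma quat_eq_iff: "p = q \<longleftrightarrow> qre p = qre q \<and> qi p = qi q \<and> qj p = qj q \<and> qk p = qk q"
  by (cases p; cases q) simp

definition qcnj :: "quat \<Rightarrow> quat" where
  "qcnj p = Quat (qre p) (- qi p) (- qj p) (- qk p)"

instantiation quat :: ring_1
begin

definition zero_quat :: quat where "0 = Quat 0 0 0 0"

definition one_quat :: quat where "1 = Quat 1 0 0 0"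

definition plus_quat :: "quat \<Rightarrow> quat \<Rightarrow> quat" where
  "p + q = Quat (qre p + qre q) (qi p + qi q) (qj p + qj q) (qk p + qk q)"

definition uminus_quat :: "quat \<Rightarrow> quat" where
  "- p = Quat (- qre p) (- qi p) (- qj p) (- qk p)"

definition minus_quat :: "quat \<Rightarrow> quat \<Rightarrow> quat" where
  "p - q = Quat (qre p - qre q) (qi p - qi q) (qj p - qj q) (qk p - qk q)"

definition times_quat :: "quat \<Rightarrow> quat \<Rightarrow> quat" where
  "p * q = Quat
     (qre p * qre q - qi p * qi q - qj p * qj q - qk p * qk q)
     (qre p * qi q + qi p * qre q + qj p * qk q - qk p * qj q)
     (qre p * qj q - qi p * qk q + qj p * qre q + qk p * qi q)
     (qre p * qk q + qi p * qj q - qj p * qi q + qk p * qre q)"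

instance
  by standard
    (simp_all add: quat_eq_iff zero_quat_def one_quat_def plus_quat_def uminus_quat_def
      minus_quat_def times_quat_def algebra_simps)

end

instantiation quat :: division_ring
begin

definition inverse_quat :: "quat \<Rightarrow> quat" where
  "inverse p = (let n = (qre p)\<^sup>2 + (qi p)\<^sup>2 + (qj p)\<^sup>2 + (qk p)\<^sup>2
     in Quat (qre p / n) (- qi p / n) (- qj p / n) (- qk p / n))"

definition divide_quat :: "quat \<Rightarrow> quat \<Rightarrow> quat" where
  "p div q = p * inverse q" for p q :: quat

instance
proof
  fix p q :: quat
  define n where "n = (qre p)\<^sup>2 + (qi p)\<^sup>2 + (qj p)\<^sup>2 + (qk p)\<^sup>2"
  have inv: "inverse p = Quat (qre p / n) (- qi p / n) (- qj p / n) (- qk p / n)"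
    by (simp add: inverse_quat_def n_def Let_def)
  have pos: "n \<noteq> 0" if "p \<noteq> 0"
    using that by (auto simp: n_def quat_eq_iff zero_quat_def add_nonneg_eq_0_iff)
  show "inverse p * p = 1" if "p \<noteq> 0"
    using pos[OF that]
    by (simp add: quat_eq_iff inv times_quat_def one_quat_def field_simps)
       (simp add: n_def power2_eq_square)
  show "p * inverse p = 1" if "p \<noteq> 0"
    using pos[OF that]
    by (simp add: quat_eq_iff inv times_quat_def one_quat_def field_simps)
       (simp add: n_def power2_eq_square)
  show "divide p q = p * inverse q" by (rule divide_quat_def)
  show "inverse (0 :: quat) = 0" by (simp add: inverse_quat_def zero_quat_def)
qed

end

instantiation quat :: real_algebra_1
begin

definition scaleR_quat :: "real \<Rightarrow> quat \<Rightarrow> quat" where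
  "r *\<^sub>R p = Quat (r * qre p) (r * qi p) (r * qj p) (r * qk p)"

instance
  by standard
    (simp_all add: quat_eq_iff plus_quat_def times_quat_def scaleR_quat_def algebra_simps)

end

instantiation quat :: real_normed_div_algebra
begin

definition norm_quat :: "quat \<Rightarrow> real" where
  "norm p = sqrt ((qre p)\<^sup>2 + (qi p)\<^sup>2 + (qj p)\<^sup>2 + (qk p)\<^sup>2)"

definition sgn_quat :: "quat \<Rightarrow> quat" where
  "sgn p = p /\<^sub>R norm p" for p :: quat

definition dist_quat :: "quat \<Rightarrow> quat \<Rightarrow> real" where
  "dist p q = norm (p - q)" for p q :: quat

definition uniformity_quat :: "(quat \<times> quat) filter" where
  "uniformity = (INF e\<in>{0<..}. principal {(p :: quat, q). dist p q < e})"

definition open_quat :: "quat set \<Rightarrow> bool" where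
  "open U \<longleftrightarrow> (\<forall>p\<in>U. \<forall>\<^sub>F (p', q) in uniformity. p' = p \<longrightarrow> q \<in> U)" for U :: "quat set"

instance
proof
  fix p q :: quat and r :: real and U :: "quat set"
  have norm_eq: "norm s = norm (qre s, qi s, qj s, qk s)" for s :: quat
    by (simp add: norm_quat_def norm_Pair add.assoc)
  show "norm p = 0 \<longleftrightarrow> p = 0"
    by (simp add: norm_quat_def quat_eq_iff zero_quat_def add_nonneg_eq_0_iff)
  show "norm (p + q) \<le> norm p + norm q"
    using norm_triangle_ineq[of "(qre p, qi p, qj p, qk p)" "(qre q, qi q, qj q, qk q)"]
    by (simp add: norm_eq plus_quat_def)
  show "norm (r *\<^sub>R p) = \<bar>r\<bar> * norm p"
    using norm_scaleR[of r "(qre p, qi p, qj p, qk p)"]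
    by (simp add: norm_eq scaleR_quat_def)
  show "norm (p * q) = norm p * norm q"
    unfolding norm_quat_def real_sqrt_mult[symmetric] times_quat_def quat.sel
    by (rule arg_cong[where f = sqrt]) algebra
qed (rule sgn_quat_def dist_quat_def uniformity_quat_def open_quat_def)+

end

definition SH :: "quat set" where
  "SH = {p. norm p = 1}"


section \<open>Chain groups\<close>

text \<open>An element of \<open>\<bbbH>\<^sup>E\<close> is a function that vanishes outside \<open>E\<close>.\<close>

definition chains :: "'e set \<Rightarrow> ('e \<Rightarrow> quat) set" where
  "chains E = {c. \<forall>e. e \<notin> E \<longrightarrow> c e = 0}"

definition chain_group :: "'e set \<Rightarrow> ('e \<Rightarrow> quat) set \<Rightarrow> bool" where
  "chain_group E C \<longleftrightarrow>
     C \<subseteq> chains E \<and> (\<lambda>e. 0) \<in> C \<and>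
     (\<forall>c\<in>C. \<forall>d\<in>C. (\<lambda>e. c e + d e) \<in> C) \<and>
     (\<forall>r. \<forall>c\<in>C. (\<lambda>e. r * c e) \<in> C)"

definition chain_support :: "('e \<Rightarrow> quat) \<Rightarrow> 'e set" where
  "chain_support c = {e. c e \<noteq> 0}"

definition elementary :: "('e \<Rightarrow> quat) set \<Rightarrow> ('e \<Rightarrow> quat) \<Rightarrow> bool" where
  "elementary C c \<longleftrightarrow> c \<in> C \<and> c \<noteq> (\<lambda>e. 0) \<and>
     \<not> (\<exists>d\<in>C. d \<noteq> (\<lambda>e. 0) \<and> chain_support d \<subset> chain_support c)"

definition SH_primitive :: "('e \<Rightarrow> quat) \<Rightarrow> bool" where
  "SH_primitive c \<longleftrightarrow> (\<forall>e. c e \<in> SH \<union> {0})"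

definition QU_chain_group :: "'e set \<Rightarrow> ('e \<Rightarrow> quat) set \<Rightarrow> bool" where
  "QU_chain_group E C \<longleftrightarrow> chain_group E C \<and>
     (\<forall>c. elementary C c \<longrightarrow>
        (\<exists>r. \<exists>c'\<in>C. SH_primitive c' \<and> c = (\<lambda>e. r * c' e)))"


section \<open>The matroid of a chain group\<close>

definition matroid_indep_of_circuits :: "'e set \<Rightarrow> 'e set set \<Rightarrow> 'e set set" where
  "matroid_indep_of_circuits E \<D> = {I. I \<subseteq> E \<and> \<not> (\<exists>D\<in>\<D>. D \<subseteq> I)}"

definition matroid_bases_of_circuits :: "'e set \<Rightarrow> 'e set set \<Rightarrow> 'e set set" where
  "matroid_bases_of_circuits E \<D> =
     {B \<in> matroid_indep_of_circuits E \<D>. \<not> (\<exists>I\<in>matroid_indep_of_circuits E \<D>. B \<subset> I)}"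

definition dual_bases :: "'e set \<Rightarrow> 'e set set \<Rightarrow> 'e set set" where
  "dual_bases E \<B> = (\<lambda>B. E - B) ` \<B>"

definition chain_group_cocircuits :: "('e \<Rightarrow> quat) set \<Rightarrow> 'e set set" where
  "chain_group_cocircuits C = chain_support ` {c. elementary C c}"

text \<open>
  \<open>M(C)\<close> is the dual of the matroid on \<open>E\<close> whose circuits are the supports of the elementary
  chains of \<open>C\<close>; the circuit axioms are verified below.
\<close>

definition chain_group_bases :: "'e set \<Rightarrow> ('e \<Rightarrow> quat) set \<Rightarrow> 'e set set" where
  "chain_group_bases E C = dual_bases E (matroid_bases_of_circuits E (chain_group_cocircuits C))"

lemma chain_support_subset: "chain_group E C \<Longrightarrow> c \<in> C \<Longrightarrow> chain_support c \<subseteq> E"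
  by (auto simp: chain_group_def chains_def chain_support_def)

lemma ex_elementary_below:
  assumes "finite E" "chain_group E C" "c \<in> C" "c \<noteq> (\<lambda>e. 0)"
  shows "\<exists>d. elementary C d \<and> chain_support d \<subseteq> chain_support c"
  using assms(3,4)
proof (induction "card (chain_support c)" arbitrary: c rule: less_induct)
  case less
  show ?case
  proof (cases "elementary C c")
    case False
    with less.prems obtain d where d: "d \<in> C" "d \<noteq> (\<lambda>e. 0)" "chain_support d \<subset> chain_support c"
      unfolding elementary_def by blast
    have "finite (chain_support c)"
      using chain_support_subset[OF assms(2) less.prems(1)] assms(1) finite_subset by blast
    then have "card (chain_support d) < card (chain_support c)"
      using d(3) psubset_card_mono by blast
    from less.hyps[OF this d(1,2)] d(3) show ?thesis by blast
  qed auto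
qed

lemma chain_group_cocircuits_nonempty: "{} \<notin> chain_group_cocircuits C"
  by (auto simp: chain_group_cocircuits_def chain_support_def elementary_def)

lemma chain_group_cocircuits_antichain:
  assumes "X \<in> chain_group_cocircuits C" "Y \<in> chain_group_cocircuits C" "X \<subseteq> Y"
  shows "X = Y"
  using assms by (auto simp: chain_group_cocircuits_def elementary_def)

lemma chain_group_cocircuits_elimination:
  assumes "finite E" "chain_group E C"
    and "X \<in> chain_group_cocircuits C" "Y \<in> chain_group_cocircuits C" "X \<noteq> Y" "e \<in> X \<inter> Y"
  shows "\<exists>Z\<in>chain_group_cocircuits C. Z \<subseteq> X \<union> Y - {e}"
proof -
  obtain c d where c: "elementary C c" "X = chain_support c"
    and d: "elementary C d" "Y = chain_support d"
    using assms(3,4) by (auto simp: chain_group_cocircuits_def)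
  have nz: "c e \<noteq> 0" "d e \<noteq> 0"
    using assms(6) c d by (auto simp: chain_support_def)
  define h where "h = (\<lambda>x. inverse (c e) * c x + (- inverse (d e)) * d x)"
  have add: "(\<lambda>x. a x + b x) \<in> C" if "a \<in> C" "b \<in> C" for a b
    using assms(2) that by (simp add: chain_group_def)
  have scale: "(\<lambda>x. r * a x) \<in> C" if "a \<in> C" for r a
    using assms(2) that by (simp add: chain_group_def)
  have "c \<in> C" "d \<in> C"
    using c d by (simp_all add: elementary_def)
  then have hC: "h \<in> C"
    unfolding h_def by (intro add scale)
  have "h e = 0" using nz by (simp add: h_def)
  then have hsub: "chain_support h \<subseteq> X \<union> Y - {e}"
    using c d by (auto simp: chain_support_def h_def)
  have "\<not> X \<subseteq> Y"
    using assms chain_group_cocircuits_antichain by blast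
  then obtain x where "x \<in> X" "x \<notin> Y" by blast
  then have "h x \<noteq> 0"
    using c d nz by (auto simp: chain_support_def h_def)
  then have "h \<noteq> (\<lambda>e. 0)" by auto
  from ex_elementary_below[OF assms(1,2) hC this] hsub show ?thesis
    by (force simp: chain_group_cocircuits_def)
qed


section \<open>Matrices over finite index sets\<close>

text \<open>An \<open>R \<times> S\<close> matrix is a function that vanishes outside \<open>R \<times> S\<close>.\<close>

definition matrices :: "'r set \<Rightarrow> 's set \<Rightarrow> ('r \<Rightarrow> 's \<Rightarrow> quat) set" where
  "matrices R S = {A. \<forall>i j. \<not> (i \<in> R \<and> j \<in> S) \<longrightarrow> A i j = 0}"

definition mmult ::
  "'k set \<Rightarrow> ('r \<Rightarrow> 'k \<Rightarrow> quat) \<Rightarrow> ('k \<Rightarrow> 's \<Rightarrow> quat) \<Rightarrow> 'r \<Rightarrow> 's \<Rightarrow> quat" where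
  "mmult K A B = (\<lambda>i j. \<Sum>k\<in>K. A i k * B k j)"

definition mid :: "'r set \<Rightarrow> 'r \<Rightarrow> 'r \<Rightarrow> quat" where
  "mid R = (\<lambda>i j. if i = j \<and> i \<in> R then 1 else 0)"

definition minverse :: "'r set \<Rightarrow> ('r \<Rightarrow> 'r \<Rightarrow> quat) \<Rightarrow> 'r \<Rightarrow> 'r \<Rightarrow> quat" where
  "minverse R A =
     (THE N. N \<in> matrices R R \<and> mmult R A N = mid R \<and> mmult R N A = mid R)"

definition adjoint_matrix :: "('r \<Rightarrow> 's \<Rightarrow> quat) \<Rightarrow> 's \<Rightarrow> 'r \<Rightarrow> quat" where
  "adjoint_matrix A = (\<lambda>j i. qcnj (A i j))"

definition row_vec_mult :: "'r set \<Rightarrow> ('r \<Rightarrow> quat) \<Rightarrow> ('r \<Rightarrow> 's \<Rightarrow> quat) \<Rightarrow> 's \<Rightarrow> quat" where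
  "row_vec_mult R z A = (\<lambda>j. \<Sum>i\<in>R. z i * A i j)"

definition full_row_rank :: "'r set \<Rightarrow> ('r \<Rightarrow> 's \<Rightarrow> quat) \<Rightarrow> bool" where
  "full_row_rank R A \<longleftrightarrow> (\<forall>z. row_vec_mult R z A = (\<lambda>j. 0) \<longrightarrow> (\<forall>i\<in>R. z i = 0))"

definition row_space :: "'r set \<Rightarrow> ('r \<Rightarrow> 's \<Rightarrow> quat) \<Rightarrow> ('s \<Rightarrow> quat) set" where
  "row_space R A = {row_vec_mult R z A | z. True}"

definition submatrix_on :: "('e \<Rightarrow> 'e \<Rightarrow> quat) \<Rightarrow> 'e set \<Rightarrow> 'e set \<Rightarrow> 'e \<Rightarrow> 'e \<Rightarrow> quat" where
  "submatrix_on A F G = (\<lambda>i j. if i \<in> F \<and> j \<in> G then A i j else 0)"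

definition projection_matrix :: "'e set \<Rightarrow> ('e \<Rightarrow> quat) set \<Rightarrow> 'e \<Rightarrow> 'e \<Rightarrow> quat" where
  "projection_matrix E C =
     (THE P. \<exists>(n::nat) A. let R = {..<n} in
        A \<in> matrices R E \<and> full_row_rank R A \<and> row_space R A = C \<and>
        P = mmult R (mmult R (adjoint_matrix A) (minverse R (mmult E A (adjoint_matrix A)))) A)"


section \<open>The determinant \<open>\<delta>\<close>\<close>

definition det_on :: "'i set \<Rightarrow> ('i \<Rightarrow> 'i \<Rightarrow> complex) \<Rightarrow> complex" where
  "det_on S A = (\<Sum>p | p permutes S. of_int (sign p) * (\<Prod>i\<in>S. A i (p i)))"

lemma det_on_UNIV: "det_on UNIV (\<lambda>i j. A $ i $ j) = det A"
  by (simp add: det_on_def det_def)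

definition phi :: "quat \<Rightarrow> complex^2^2" where
  "phi p = vector [vector [Complex (qre p) (qi p), Complex (qj p) (qk p)],
                   vector [Complex (- qj p) (qk p), Complex (qre p) (- qi p)]]"

definition z2 :: "('e \<Rightarrow> 'e \<Rightarrow> complex^2^2) \<Rightarrow> 'e \<times> 2 \<Rightarrow> 'e \<times> 2 \<Rightarrow> complex" where
  "z2 D = (\<lambda>(e, i) (f, j). D e f $ i $ j)"

text \<open>\<open>delta F D\<close> is \<open>\<delta>(D)\<close> for an \<open>F \<times> F\<close> matrix \<open>D\<close>.\<close>

definition delta :: "'e set \<Rightarrow> ('e \<Rightarrow> 'e \<Rightarrow> quat) \<Rightarrow> real" where
  "delta F D = sqrt (cmod (det_on (F \<times> UNIV) (z2 (\<lambda>e f. phi (D e f)))))"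

lemma delta_empty: "delta {} D = 1"
  by (simp add: delta_def det_on_def)

end

theory Submission
  imports Defs
begin

text \<open>
  Each basis \<open>B\<close> gives a projection of the row space \<open>\<bbbH>\<^sup>E\<close> onto \<open>C\<close>, sending \<open>v\<close> to the chain that
  agrees with \<open>v\<close> on \<open>B\<close>. Their average is again a projection onto \<open>C\<close>, and it is Hermitian: entries
  of fundamental chains have norm 0 or 1, and the exchange \<open>B \<mapsto> B - f + e\<close> turns the \<open>(f, e)\<close> entry of
  one projection into its inverse, hence its conjugate, as the \<open>(e, f)\<close> entry of another. So the
  average is \<open>P\<^sub>C\<close>, and its diagonal entry at \<open>e\<close> is the proportion of bases that contain \<open>e\<close>. Larger
  \<open>F\<close> reduce to this by induction: the Schur complement of \<open>P\<^sub>C\<close> at a nonzero diagonal entry \<open>e\<close> is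
  the projection matrix of \<open>{c \<in> C. c\<^sub>e = 0}\<close>, whose bases are the sets \<open>B - e\<close> for bases \<open>B \<ni> e\<close>.
\<close>

section \<open>Quaternion conjugation\<close>

lemma qcnj_zero [simp]: "qcnj 0 = 0"
  and qcnj_one [simp]: "qcnj 1 = 1"
  and qcnj_qcnj [simp]: "qcnj (qcnj p) = p"
  by (simp_all add: quat_eq_iff qcnj_def zero_quat_def one_quat_def)

lemma qcnj_add: "qcnj (p + q) = qcnj p + qcnj q"
  by (simp add: quat_eq_iff qcnj_def plus_quat_def)

lemma qcnj_diff: "qcnj (p - q) = qcnj p - qcnj q"
  by (simp add: quat_eq_iff qcnj_def minus_quat_def)

lemma qcnj_mult: "qcnj (p * q) = qcnj q * qcnj p"
  by (simp add: quat_eq_iff qcnj_def times_quat_def algebra_simps)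

lemma qcnj_scaleR: "qcnj (r *\<^sub>R p) = r *\<^sub>R qcnj p"
  by (simp add: quat_eq_iff qcnj_def scaleR_quat_def)

lemma qcnj_sum: "qcnj (sum f S) = (\<Sum>i\<in>S. qcnj (f i))"
  by (induction S rule: infinite_finite_induct) (simp_all add: qcnj_add)

lemma mult_qcnj: "p * qcnj p = of_real ((norm p)\<^sup>2)"
  by (simp add: quat_eq_iff qcnj_def times_quat_def norm_quat_def of_real_def scaleR_quat_def
      one_quat_def power2_eq_square)

lemma inverse_eq_qcnj: "norm p = 1 \<Longrightarrow> inverse p = qcnj p"
  by (rule inverse_unique) (simp add: mult_qcnj)

lemma qcnj_inverse: "qcnj (inverse p) = inverse (qcnj p)"
proof (cases "p = 0")
  case False
  then have "qcnj p * qcnj (inverse p) = 1"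
    by (simp flip: qcnj_mult)
  then show ?thesis
    by (metis inverse_unique)
qed simp


section \<open>Matrices over finite index sets\<close>

lemma mmult_assoc:
  "mmult L (mmult K A B) D = mmult K A (mmult L B D)"
  by (intro ext)
    (simp add: mmult_def sum_distrib_left sum_distrib_right mult.assoc,
     rule sum.swap)

lemma adjoint_mmult:
  "adjoint_matrix (mmult K A B) = mmult K (adjoint_matrix B) (adjoint_matrix A)"
  by (intro ext) (simp add: adjoint_matrix_def mmult_def qcnj_sum qcnj_mult)

lemma adjoint_adjoint [simp]: "adjoint_matrix (adjoint_matrix A) = A"
  by (simp add: adjoint_matrix_def)

lemma adjoint_mid: "adjoint_matrix (mid R) = mid R"
  by (intro ext) (auto simp: adjoint_matrix_def mid_def)

lemma mmult_mid_left:
  assumes "finite R" "\<And>i j. i \<notin> R \<Longrightarrow> A i j = 0"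
  shows "mmult R (mid R) A = A"
proof (intro ext)
  fix i j
  have "mmult R (mid R) A i j = (\<Sum>k\<in>R. if k = i then A i j else 0)"
    unfolding mmult_def mid_def by (intro sum.cong) auto
  then show "mmult R (mid R) A i j = A i j"
    using assms by simp
qed

lemma mmult_mid_right:
  assumes "finite R" "\<And>i j. j \<notin> R \<Longrightarrow> A i j = 0"
  shows "mmult R A (mid R) = A"
proof (intro ext)
  fix i j
  have "mmult R A (mid R) i j = (\<Sum>k\<in>R. if k = j then A i j else 0)"
    unfolding mmult_def mid_def by (intro sum.cong) auto
  then show "mmult R A (mid R) i j = A i j"
    using assms by simp
qed

text \<open>Two-sided inverses are unique, which settles the definite description in
  \<open>minverse\<close>; entries outside \<open>R \<times> R\<close> are pinned to zero, so that
  uniqueness holds for functions.\<close>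

lemma minverse_eqI:
  assumes "finite R" "N \<in> matrices R R" "mmult R A N = mid R" "mmult R N A = mid R"
  shows "minverse R A = N"
  unfolding minverse_def
proof (rule the_equality)
  fix N' assume N': "N' \<in> matrices R R \<and> mmult R A N' = mid R \<and> mmult R N' A = mid R"
  have "N' = mmult R N' (mmult R A N)"
    unfolding assms(3) using N' assms(1) by (subst mmult_mid_right) (auto simp: matrices_def)
  also have "\<dots> = mmult R (mid R) N"
    using N' by (simp flip: mmult_assoc)
  also have "\<dots> = N"
    using assms by (intro mmult_mid_left) (auto simp: matrices_def)
  finally show "N' = N" .
qed (use assms in auto)

section \<open>Row spaces and the projection onto them\<close>

lemma row_mmult: "mmult K A B i = row_vec_mult K (A i) B"
  by (simp add: mmult_def row_vec_mult_def)

lemma row_in_row_space: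
  assumes "finite R" "i \<in> R"
  shows "A i \<in> row_space R A"
proof -
  have "row_vec_mult R (\<lambda>k. if k = i then 1 else 0) A = A i"
    using assms by (auto simp: row_vec_mult_def if_distrib[of "\<lambda>x. x * _"] cong: if_cong)
  then show ?thesis
    unfolding row_space_def by (metis (mono_tags, lifting) mem_Collect_eq)
qed

text \<open>Each row of \<open>X - Y\<close> is a coefficient vector annihilating \<open>A\<close>.
  Only columns in \<open>R\<close> enter the products, so \<open>X\<close> and \<open>Y\<close> are
  taken to vanish outside \<open>R\<close>.\<close>

lemma full_row_rank_cancel:
  assumes "full_row_rank R A" "mmult R X A = mmult R Y A"
    and "\<And>i j. j \<notin> R \<Longrightarrow> X i j = 0" "\<And>i j. j \<notin> R \<Longrightarrow> Y i j = 0"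
  shows "X = Y"
proof (intro ext)
  fix i j
  have "row_vec_mult R (\<lambda>k. X i k - Y i k) A = (\<lambda>j. 0)"
    using fun_cong[OF assms(2), of i]
    by (simp add: row_vec_mult_def mmult_def fun_eq_iff left_diff_distrib sum_subtractf)
  with assms(1) have "k \<in> R \<Longrightarrow> X i k - Y i k = 0" for k
    unfolding full_row_rank_def by blast
  then show "X i j = Y i j"
    using assms(3,4) by (cases "j \<in> R") auto
qed

text \<open>
  Write \<open>Q = X A\<close>. Cancelling \<open>A\<close> in \<open>A X A = A Q = A\<close> gives \<open>A X = I\<close>, and
  \<open>X A = Q = Q\<^sup>\<dagger> = A\<^sup>\<dagger> X\<^sup>\<dagger>\<close> gives \<open>X = A\<^sup>\<dagger> X\<^sup>\<dagger> X\<close>, so that \<open>X\<^sup>\<dagger> X\<close> is the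
  inverse of \<open>A A\<^sup>\<dagger>\<close>.
\<close>

lemma hermitian_projection_eq:
  assumes fin: "finite E" "finite R"
    and A: "A \<in> matrices R E" "full_row_rank R A"
    and Q: "Q \<in> matrices E E" "adjoint_matrix Q = Q"
    and Q_row: "\<And>i. i \<in> E \<Longrightarrow> Q i \<in> row_space R A"
    and Q_fix: "\<And>c. c \<in> row_space R A \<Longrightarrow> row_vec_mult E c Q = c"
  shows "mmult R (mmult R (adjoint_matrix A) (minverse R (mmult E A (adjoint_matrix A)))) A = Q"
proof -
  have "\<exists>z. row_vec_mult R z A = Q i" if "i \<in> E" for i
    using Q_row[OF that] by (auto simp: row_space_def)
  then obtain Z where Z: "i \<in> E \<Longrightarrow> row_vec_mult R (Z i) A = Q i" for i
    by metis
  \<comment> \<open>The rows of \<open>Q\<close> constrain \<open>Z\<close> only on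
    \<open>E \<times> R\<close>; cutting it off elsewhere makes it a matrix to which cancellation
    applies.\<close>
  define X where "X = (\<lambda>i j. if i \<in> E \<and> j \<in> R then Z i j else 0)"
  have X0: "X i j = 0" if "i \<notin> E \<or> j \<notin> R" for i j
    using that by (auto simp: X_def)
  have XA: "mmult R X A = Q"
  proof (intro ext)
    fix i j
    show "mmult R X A i j = Q i j"
    proof (cases "i \<in> E")
      case True
      then have "mmult R X A i j = row_vec_mult R (Z i) A j"
        unfolding mmult_def row_vec_mult_def by (intro sum.cong) (auto simp: X_def)
      with Z True show ?thesis by simp
    next
      case False
      then show ?thesis using Q(1) by (simp add: mmult_def X0 matrices_def)
    qed
  qed
  have A0: "A i j = 0" if "i \<notin> R \<or> j \<notin> E" for i j
    using that A(1) by (auto simp: matrices_def)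
  have AQ: "mmult E A Q = A"
  proof
    fix i
    show "mmult E A Q i = A i"
    proof (cases "i \<in> R")
      case True
      then show ?thesis
        unfolding row_mmult by (intro Q_fix row_in_row_space fin)
    next
      case False
      then show ?thesis by (simp add: mmult_def A0 fun_eq_iff)
    qed
  qed
  have AX: "mmult E A X = mid R"
  proof (rule full_row_rank_cancel[OF A(2)])
    show "mmult R (mmult E A X) A = mmult R (mid R) A"
      using fin by (simp add: mmult_assoc XA AQ mmult_mid_left A0)
  qed (auto simp: mmult_def X0 mid_def)
  define N where "N = mmult E (adjoint_matrix X) X"
  have "X = mmult R X (mmult E A X)"
    unfolding AX by (rule mmult_mid_right[symmetric]) (auto simp: fin X0)
  also have "\<dots> = mmult E (adjoint_matrix Q) X"
    by (simp add: Q(2) XA flip: mmult_assoc)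
  also have "\<dots> = mmult R (adjoint_matrix A) N"
    by (simp add: N_def XA[symmetric] adjoint_mmult mmult_assoc)
  finally have XN: "mmult R (adjoint_matrix A) N = X" ..
  have inv: "mmult R (mmult E A (adjoint_matrix A)) N = mid R"
    by (simp add: mmult_assoc XN AX)
  have "minverse R (mmult E A (adjoint_matrix A)) = N"
  proof (rule minverse_eqI[OF fin(2) _ inv])
    show "N \<in> matrices R R"
      by (auto simp: matrices_def N_def mmult_def adjoint_matrix_def X0)
    \<comment> \<open>Taking adjoints in \<open>inv\<close> reverses the product, and both factors
      are Hermitian.\<close>
    show "mmult R N (mmult E A (adjoint_matrix A)) = mid R"
      using arg_cong[OF inv, of adjoint_matrix]
      by (simp add: adjoint_mmult adjoint_mid) (simp add: N_def adjoint_mmult)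
  qed
  then show ?thesis
    by (simp add: XN XA)
qed


section \<open>Bases and fundamental chains\<close>

locale finite_chain_group =
  fixes E :: "'e set" and C :: "('e \<Rightarrow> quat) set"
  assumes fin: "finite E" and chain_group: "chain_group E C"
begin

lemma zero_chain: "(\<lambda>e. 0) \<in> C"
  using chain_group by (simp add: chain_group_def)

lemma add_chain: "c \<in> C \<Longrightarrow> d \<in> C \<Longrightarrow> (\<lambda>e. c e + d e) \<in> C"
  using chain_group by (simp add: chain_group_def)

lemma scale_chain: "c \<in> C \<Longrightarrow> (\<lambda>e. r * c e) \<in> C"
  using chain_group by (simp add: chain_group_def)

lemma diff_chain: "c \<in> C \<Longrightarrow> d \<in> C \<Longrightarrow> (\<lambda>e. c e - r * d e) \<in> C"
  using add_chain[OF _ scale_chain[of d "- r"], of c] by simp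

lemma sum_chain: "(\<And>i. i \<in> I \<Longrightarrow> g i \<in> C) \<Longrightarrow> (\<lambda>e. \<Sum>i\<in>I. r i * g i e) \<in> C"
  by (induction I rule: infinite_finite_induct) (simp_all add: zero_chain add_chain scale_chain)

lemma chain_outside: "c \<in> C \<Longrightarrow> e \<notin> E \<Longrightarrow> c e = 0"
  using chain_group by (auto simp: chain_group_def chains_def)

section \<open>Independence and bases in terms of chains\<close>

lemma indep_iff:
  "X \<in> matroid_indep_of_circuits E (chain_group_cocircuits C) \<longleftrightarrow>
    X \<subseteq> E \<and> (\<forall>c\<in>C. chain_support c \<subseteq> X \<longrightarrow> c = (\<lambda>e. 0))"
proof -
  have "(\<exists>D\<in>chain_group_cocircuits C. D \<subseteq> X) \<longleftrightarrow>
    (\<exists>c\<in>C. chain_support c \<subseteq> X \<and> c \<noteq> (\<lambda>e. 0))"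
  proof
    assume "\<exists>D\<in>chain_group_cocircuits C. D \<subseteq> X"
    then show "\<exists>c\<in>C. chain_support c \<subseteq> X \<and> c \<noteq> (\<lambda>e. 0)"
      by (auto simp: chain_group_cocircuits_def elementary_def)
  next
    assume "\<exists>c\<in>C. chain_support c \<subseteq> X \<and> c \<noteq> (\<lambda>e. 0)"
    then obtain c where c: "c \<in> C" "chain_support c \<subseteq> X" "c \<noteq> (\<lambda>e. 0)" by blast
    with ex_elementary_below[OF fin chain_group c(1,3)]
    show "\<exists>D\<in>chain_group_cocircuits C. D \<subseteq> X"
      unfolding chain_group_cocircuits_def by blast
  qed
  then show ?thesis
    by (auto simp: matroid_indep_of_circuits_def)
qed

lemma indep_compl_iff:
  assumes "B \<subseteq> E"
  shows "E - B \<in> matroid_indep_of_circuits E (chain_group_cocircuits C) \<longleftrightarrow>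
    (\<forall>c\<in>C. (\<forall>f\<in>B. c f = 0) \<longrightarrow> c = (\<lambda>e. 0))"
proof -
  have "chain_support c \<subseteq> E - B \<longleftrightarrow> (\<forall>f\<in>B. c f = 0)" if "c \<in> C" for c
    using chain_outside[OF that] assms by (auto simp: chain_support_def)
  then show ?thesis
    by (auto simp: indep_iff)
qed

text \<open>\<open>B\<close> is a basis exactly when restriction to \<open>B\<close> maps
  \<open>C\<close> bijectively onto the functions on \<open>B\<close>: independence of the
  complement is injectivity, and its maximality yields the dual chains.\<close>

lemma basis_iff:
  "B \<in> chain_group_bases E C \<longleftrightarrow> B \<subseteq> E \<and>
    (\<forall>c\<in>C. (\<forall>f\<in>B. c f = 0) \<longrightarrow> c = (\<lambda>e. 0)) \<and>
    (\<forall>f\<in>B. \<exists>c\<in>C. c f = 1 \<and> (\<forall>g\<in>B - {f}. c g = 0))"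
    (is "_ \<longleftrightarrow> B \<subseteq> E \<and> ?sep B \<and> ?dual")
proof -
  let ?I = "matroid_indep_of_circuits E (chain_group_cocircuits C)"
  have "B \<in> chain_group_bases E C \<longleftrightarrow> B \<subseteq> E \<and> E - B \<in> ?I \<and> \<not> (\<exists>I\<in>?I. E - B \<subset> I)"
  proof
    assume "B \<in> chain_group_bases E C"
    then obtain X where X: "X \<in> ?I" "\<not> (\<exists>I\<in>?I. X \<subset> I)" "B = E - X"
      by (auto simp: chain_group_bases_def dual_bases_def matroid_bases_of_circuits_def)
    moreover have "E - (E - X) = X"
      using X(1) by (auto simp: indep_iff)
    ultimately show "B \<subseteq> E \<and> E - B \<in> ?I \<and> \<not> (\<exists>I\<in>?I. E - B \<subset> I)"
      by (metis Diff_subset)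
  next
    assume B: "B \<subseteq> E \<and> E - B \<in> ?I \<and> \<not> (\<exists>I\<in>?I. E - B \<subset> I)"
    then have "E - B \<in> matroid_bases_of_circuits E (chain_group_cocircuits C)"
      by (simp add: matroid_bases_of_circuits_def)
    moreover have "B = E - (E - B)"
      using B by blast
    ultimately show "B \<in> chain_group_bases E C"
      unfolding chain_group_bases_def dual_bases_def by (rule rev_image_eqI)
  qed
  also have "\<dots> \<longleftrightarrow> B \<subseteq> E \<and> ?sep B \<and> ?dual"
  proof (rule conj_cong[OF refl], goal_cases)
    case 1
    show ?case
      unfolding indep_compl_iff[OF 1]
    proof (rule conj_cong[OF refl])
      assume sep: "?sep B"
      show "\<not> (\<exists>I\<in>?I. E - B \<subset> I) \<longleftrightarrow> ?dual"
      proof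
        assume max: "\<not> (\<exists>I\<in>?I. E - B \<subset> I)"
        show ?dual
        proof
          fix f assume f: "f \<in> B"
          then have "E - B \<subset> E - (B - {f})" "B - {f} \<subseteq> E"
            using 1 by blast+
          \<comment> \<open>By maximality some nonzero chain vanishes on \<open>B - {f}\<close>;
            separation makes its value at \<open>f\<close> nonzero, so it can be normalized
            there.\<close>
          with max have "\<not> (\<forall>c\<in>C. (\<forall>g\<in>B - {f}. c g = 0) \<longrightarrow> c = (\<lambda>e. 0))"
            using indep_compl_iff by blast
          then obtain c where c: "c \<in> C" "\<forall>g\<in>B - {f}. c g = 0" "c \<noteq> (\<lambda>e. 0)"
            by blast
          with sep have "c f \<noteq> 0"
            by blast
          then show "\<exists>c\<in>C. c f = 1 \<and> (\<forall>g\<in>B - {f}. c g = 0)"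
            using c scale_chain[OF c(1), of "inverse (c f)"]
            by (intro bexI[of _ "\<lambda>e. inverse (c f) * c e"]) simp_all
        qed
      next
        assume dual: ?dual
        show "\<not> (\<exists>I\<in>?I. E - B \<subset> I)"
        proof
          assume "\<exists>I\<in>?I. E - B \<subset> I"
          then obtain I f where I: "I \<in> ?I" "E - B \<subset> I" "f \<in> I" "f \<notin> E - B"
            by blast
          then have "f \<in> B"
            by (auto simp: indep_iff)
          with dual obtain c where c: "c \<in> C" "c f = 1" "\<forall>g\<in>B - {f}. c g = 0"
            by blast
          \<comment> \<open>\<open>c\<close> vanishes on \<open>B - {f}\<close> and outside
            \<open>E\<close>, which leaves only \<open>(E - B) \<union> {f}\<close>, a subset of
            \<open>I\<close>.\<close>
          have "chain_support c \<subseteq> I"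
            using c I chain_outside[OF c(1)] by (auto simp: chain_support_def)
          with I(1) c(1) have "c = (\<lambda>e. 0)"
            by (auto simp: indep_iff)
          with c(2) show False by simp
        qed
      qed
    qed
  qed
  finally show ?thesis .
qed

lemma basis_subset: "B \<in> chain_group_bases E C \<Longrightarrow> B \<subseteq> E"
  by (simp add: basis_iff)

lemma finite_bases: "finite (chain_group_bases E C)"
  by (rule finite_subset[of _ "Pow E"]) (use basis_subset fin in auto)

lemma finite_basis: "B \<in> chain_group_bases E C \<Longrightarrow> finite B"
  using basis_subset fin finite_subset by blast

lemma basis_separates:
  assumes "B \<in> chain_group_bases E C" "c \<in> C" "d \<in> C" "\<And>f. f \<in> B \<Longrightarrow> c f = d f"
  shows "c = d"
proof -
  have "(\<lambda>e. c e - 1 * d e) = (\<lambda>e. 0)"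
    using assms(1,4) diff_chain[OF assms(2,3), of 1] unfolding basis_iff by simp
  then show ?thesis by (simp add: fun_eq_iff)
qed

lemma bases_nonempty: "chain_group_bases E C \<noteq> {}"
proof -
  let ?I = "matroid_indep_of_circuits E (chain_group_cocircuits C)"
  have "finite ?I"
    using fin by (auto simp: matroid_indep_of_circuits_def)
  moreover have "{} \<in> ?I"
    by (auto simp: indep_iff chain_support_def)
  ultimately obtain X where "X \<in> ?I" "\<forall>Y\<in>?I. X \<subseteq> Y \<longrightarrow> X = Y"
    using finite_has_maximal2[of ?I "{}"] by blast
  then have "X \<in> matroid_bases_of_circuits E (chain_group_cocircuits C)"
    by (auto simp: matroid_bases_of_circuits_def)
  then show ?thesis
    by (auto simp: chain_group_bases_def dual_bases_def)
qed

section \<open>Fundamental chains and basis exchange\<close>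

definition fundamental_chain :: "'e set \<Rightarrow> 'e \<Rightarrow> 'e \<Rightarrow> quat" where
  "fundamental_chain B f = (SOME c. c \<in> C \<and> c f = 1 \<and> (\<forall>g\<in>B - {f}. c g = 0))"

context
  fixes B f
  assumes B: "B \<in> chain_group_bases E C" and f: "f \<in> B"
begin

lemma fundamental_chain:
  "fundamental_chain B f \<in> C" "fundamental_chain B f f = 1"
  "g \<in> B \<Longrightarrow> fundamental_chain B f g = (if g = f then 1 else 0)"
proof -
  have "\<exists>c. c \<in> C \<and> c f = 1 \<and> (\<forall>g\<in>B - {f}. c g = 0)"
    using B f by (auto simp: basis_iff)
  from someI_ex[OF this]
  show "fundamental_chain B f \<in> C" "fundamental_chain B f f = 1"
    "g \<in> B \<Longrightarrow> fundamental_chain B f g = (if g = f then 1 else 0)"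
    by (auto simp: fundamental_chain_def)
qed

text \<open>Both sides agree on \<open>B\<close>, and a basis separates chains. In particular the
  choice made in \<open>fundamental_chain\<close> is the only possible one.\<close>

lemma fundamental_chain_unique:
  assumes "c \<in> C" "\<And>g. g \<in> B - {f} \<Longrightarrow> c g = 0"
  shows "c = (\<lambda>e. c f * fundamental_chain B f e)"
  by (rule basis_separates[OF B]) (use assms fundamental_chain in \<open>auto simp: scale_chain\<close>)

text \<open>A chain of smaller support also vanishes on \<open>B - {f}\<close>, hence is a left
  multiple of the fundamental chain; a nonzero multiple has the same support.\<close>

lemma elementary_fundamental_chain: "elementary C (fundamental_chain B f)"
  unfolding elementary_def
proof (intro conjI notI)
  assume "\<exists>d\<in>C. d \<noteq> (\<lambda>e. 0) \<and> chain_support d \<subset> chain_support (fundamental_chain B f)"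
  then obtain d where d: "d \<in> C" "d \<noteq> (\<lambda>e. 0)"
    "chain_support d \<subset> chain_support (fundamental_chain B f)"
    by blast
  have "d g = 0" if "g \<in> B - {f}" for g
    using that d(3) fundamental_chain(3)[of g] by (auto simp: chain_support_def)
  from fundamental_chain_unique[OF d(1) this] have *: "d e = d f * fundamental_chain B f e" for e
    by (rule fun_cong)
  have "d f \<noteq> 0"
  proof
    assume "d f = 0"
    then have "d e = 0" for e
      by (subst *) simp
    with d(2) show False by auto
  qed
  then have "d e \<noteq> 0 \<longleftrightarrow> fundamental_chain B f e \<noteq> 0" for e
    by (subst *) simp
  then have "chain_support d = chain_support (fundamental_chain B f)"
    by (simp add: chain_support_def)
  with d(3) show False by blast
qed (use fundamental_chain in \<open>auto simp: fun_eq_iff\<close>)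

end

text \<open>This is a pivot: dividing the chain of \<open>f\<close> by its entry at \<open>e\<close>
  gives the chain of \<open>e\<close> for the new basis. The last part makes the exchange
  invertible, for use in reindexing; \<open>e = f\<close> is allowed and changes nothing.\<close>

lemma fundamental_chain_exchange:
  assumes B: "B \<in> chain_group_bases E C" and f: "f \<in> B" and e: "fundamental_chain B f e \<noteq> 0"
  defines "B' \<equiv> insert e (B - {f})"
  shows "B' \<in> chain_group_bases E C"
    and "fundamental_chain B' e f = inverse (fundamental_chain B f e)"
    and "insert f (B' - {e}) = B"
proof -
  let ?c = "fundamental_chain B f"
  note fc = fundamental_chain[OF B f]
  have eB: "e = f \<or> e \<notin> B"
    using e fc(3)[of e] by (auto split: if_splits)
  then show "insert f (B' - {e}) = B"
    using f by (auto simp: B'_def)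
  have "e \<in> E"
    using e fc(1) chain_outside by blast
  show B': "B' \<in> chain_group_bases E C"
    unfolding basis_iff
  proof (intro conjI ballI impI)
    show "B' \<subseteq> E"
      using \<open>e \<in> E\<close> basis_subset[OF B] by (auto simp: B'_def)
  next
    fix d assume d: "d \<in> C" "\<forall>g\<in>B'. d g = 0"
    then have *: "d x = d f * ?c x" for x
      by (intro fun_cong[OF fundamental_chain_unique[OF B f]]) (auto simp: B'_def)
    have "d f = 0"
      using *[of e] d(2) e by (simp add: B'_def)
    show "d = (\<lambda>e. 0)"
      by (intro ext, subst *) (simp add: \<open>d f = 0\<close>)
  next
    fix g assume g: "g \<in> B'"
    show "\<exists>c\<in>C. c g = 1 \<and> (\<forall>h\<in>B' - {g}. c h = 0)"
    proof (cases "g = e")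
      case True
      then show ?thesis
        using e fc scale_chain[OF fc(1), of "inverse (?c e)"] eB
        by (intro bexI[of _ "\<lambda>x. inverse (?c e) * ?c x"]) (auto simp: B'_def)
    next
      case False
      then have gB: "g \<in> B" "g \<noteq> f"
        using g by (auto simp: B'_def)
      then obtain d where d: "d \<in> C" "d g = 1" "\<forall>h\<in>B - {g}. d h = 0"
        using B by (auto simp: basis_iff)
      \<comment> \<open>A multiple of the chain of \<open>f\<close> clears the entry of
        \<open>d\<close> at \<open>e\<close>; it leaves the entries on \<open>B - {f}\<close> alone,
        since that chain vanishes there.\<close>
      have "(\<lambda>x. d x - (d e * inverse (?c e)) * ?c x) \<in> C"
        by (intro diff_chain d fc)
      moreover have "d e - (d e * inverse (?c e)) * ?c e = 0"
        using e by (simp add: mult.assoc)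
      ultimately show ?thesis
        using d gB fc(3)
        by (intro bexI[of _ "\<lambda>x. d x - (d e * inverse (?c e)) * ?c x"]) (auto simp: B'_def split: if_splits)
    qed
  qed
  have "e \<in> B'" by (simp add: B'_def)
  have "(\<lambda>x. inverse (?c e) * ?c x) = fundamental_chain B' e"
  proof (rule basis_separates[OF B' scale_chain[OF fc(1)] fundamental_chain(1)[OF B' \<open>e \<in> B'\<close>]])
    fix g assume "g \<in> B'"
    then show "inverse (?c e) * ?c g = fundamental_chain B' e g"
      using e eB fc(3)[of g] fundamental_chain(3)[OF B' \<open>e \<in> B'\<close>, of g] by (auto simp: B'_def)
  qed
  then show "fundamental_chain B' e f = inverse (fundamental_chain B f e)"
    by (metis fc(2) mult.right_neutral)
qed

lemma basis_expansion:
  assumes B: "B \<in> chain_group_bases E C" and c: "c \<in> C"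
  shows "c = (\<lambda>e. \<Sum>f\<in>B. c f * fundamental_chain B f e)"
proof (rule basis_separates[OF B c])
  fix g assume g: "g \<in> B"
  have "(\<Sum>f\<in>B. c f * fundamental_chain B f g) = (\<Sum>f\<in>B. if f = g then c g else 0)"
    using g by (intro sum.cong) (auto simp: fundamental_chain[OF B])
  then show "c g = (\<Sum>f\<in>B. c f * fundamental_chain B f g)"
    using g finite_basis[OF B] by simp
qed (intro sum_chain fundamental_chain[OF B])

text \<open>The fundamental chains of one basis, enumerated, serve as rows. They restrict to an
  identity matrix on the basis, which gives full row rank.\<close>

lemma ex_matrix_row_space:
  "\<exists>(n::nat) A. A \<in> matrices {..<n} E \<and> full_row_rank {..<n} A \<and> row_space {..<n} A = C"
proof -
  obtain B where B: "B \<in> chain_group_bases E C"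
    using bases_nonempty by blast
  obtain h where h: "bij_betw h {..<card B} B"
    using ex_bij_betw_nat_finite[OF finite_basis[OF B]] by (auto simp: atLeast0LessThan)
  let ?R = "{..<card B}"
  define A where "A = (\<lambda>i. if i \<in> ?R then fundamental_chain B (h i) else (\<lambda>_. 0))"
  have hB: "h i \<in> B" if "i \<in> ?R" for i
    using h that by (rule bij_betw_apply)
  have rows: "A i \<in> C" if "i \<in> ?R" for i
    using that fundamental_chain(1)[OF B hB[OF that]] by (simp add: A_def)
  have rv: "row_vec_mult ?R z A e = (\<Sum>i\<in>?R. z i * fundamental_chain B (h i) e)" for z e
    unfolding row_vec_mult_def by (intro sum.cong) (auto simp: A_def)
  have "A \<in> matrices ?R E"
    using rows chain_outside by (fastforce simp: matrices_def A_def)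
  moreover have "full_row_rank ?R A"
    unfolding full_row_rank_def
  proof (intro allI impI ballI)
    fix z i assume z: "row_vec_mult ?R z A = (\<lambda>j. 0)" and i: "i \<in> ?R"
    have "0 = (\<Sum>k\<in>?R. z k * fundamental_chain B (h k) (h i))"
      using fun_cong[OF z, of "h i"] by (simp add: rv)
    also have "\<dots> = (\<Sum>k\<in>?R. if k = i then z i else 0)"
      using i by (intro sum.cong refl)
        (auto simp: fundamental_chain(3)[OF B] hB bij_betw_imp_inj_on[OF h, THEN inj_on_eq_iff])
    also have "\<dots> = z i"
      using i by simp
    finally show "z i = 0" ..
  qed
  moreover have "row_space ?R A = C"
  proof (intro equalityI subsetI)
    fix c assume "c \<in> row_space ?R A"
    then show "c \<in> C"
      using sum_chain[of ?R A] rows by (auto simp: row_space_def row_vec_mult_def)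
  next
    fix c assume c: "c \<in> C"
    have "c = row_vec_mult ?R (\<lambda>i. c (h i)) A"
    proof
      fix e
      have "c e = (\<Sum>f\<in>B. c f * fundamental_chain B f e)"
        using basis_expansion[OF B c] by (rule fun_cong)
      also have "\<dots> = row_vec_mult ?R (\<lambda>i. c (h i)) A e"
        unfolding rv by (rule sum.reindex_bij_betw[OF h, symmetric])
      finally show "c e = row_vec_mult ?R (\<lambda>i. c (h i)) A e" .
    qed
    then show "c \<in> row_space ?R A"
      unfolding row_space_def by blast
  qed
  ultimately show ?thesis by blast
qed

text \<open>By \<open>hermitian_projection_eq\<close> every matrix representing \<open>C\<close>
  yields the same \<open>Q\<close>, so the definite description is resolved without choosing a
  representation.\<close>

lemma projection_matrix_eqI:
  assumes "Q \<in> matrices E E" "adjoint_matrix Q = Q"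
    and "\<And>i. i \<in> E \<Longrightarrow> Q i \<in> C" "\<And>c. c \<in> C \<Longrightarrow> row_vec_mult E c Q = c"
  shows "projection_matrix E C = Q"
proof -
  have *: "mmult R (mmult R (adjoint_matrix A) (minverse R (mmult E A (adjoint_matrix A)))) A = Q"
    if "R = {..<n}" "A \<in> matrices R E" "full_row_rank R A" "row_space R A = C" for R A and n :: nat
    using that assms fin by (intro hermitian_projection_eq) auto
  obtain n :: nat and A where
    "A \<in> matrices {..<n} E" "full_row_rank {..<n} A" "row_space {..<n} A = C"
    using ex_matrix_row_space by blast
  then show ?thesis
    unfolding projection_matrix_def Let_def
    by (intro the_equality exI[of _ n] exI[of _ A]) (auto simp: *)
qed

text \<open>Chains vanishing at \<open>e\<close> present the matroid contraction by
  \<open>e\<close>, kept on the ground set \<open>E\<close> with \<open>e\<close> as a loop. The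
  chain \<open>d\<close> witnesses that \<open>e\<close> is not a loop of the original
  matroid.\<close>

lemma bases_contract:
  assumes d: "d \<in> C" "d e \<noteq> 0"
  shows "B \<in> chain_group_bases E {c \<in> C. c e = 0} \<longleftrightarrow>
    e \<notin> B \<and> insert e B \<in> chain_group_bases E C"
proof -
  let ?C = "{c \<in> C. c e = 0}"
  interpret contr: finite_chain_group E ?C
    using fin chain_group by unfold_locales (auto simp: chain_group_def)
  have "e \<in> E"
    using d chain_outside by blast
  show ?thesis
  proof
    assume B: "B \<in> chain_group_bases E ?C"
    have dual: "\<exists>c\<in>?C. c f = 1 \<and> (\<forall>g\<in>B - {f}. c g = 0)" if "f \<in> B" for f
      using B that unfolding contr.basis_iff by blast
    have sep: "c = (\<lambda>e. 0)" if "c \<in> C" "c e = 0" "\<forall>f\<in>B. c f = 0" for c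
      using B that unfolding contr.basis_iff by blast
    have eB: "e \<notin> B"
      using dual[of e] by auto
    moreover have "insert e B \<in> chain_group_bases E C"
      unfolding basis_iff
    proof (intro conjI ballI impI)
      show "insert e B \<subseteq> E"
        using contr.basis_subset[OF B] \<open>e \<in> E\<close> by simp
    next
      fix c assume "c \<in> C" "\<forall>f\<in>insert e B. c f = 0"
      then show "c = (\<lambda>e. 0)" using sep by simp
    next
      fix f assume f: "f \<in> insert e B"
      show "\<exists>c\<in>C. c f = 1 \<and> (\<forall>g\<in>insert e B - {f}. c g = 0)"
      proof (cases "f = e")
        case False
        with f dual obtain c where "c \<in> ?C" "c f = 1" "\<forall>g\<in>B - {f}. c g = 0"
          by blast
        then show ?thesis by auto
      next
        case True
        let ?fc = "contr.fundamental_chain B"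
        \<comment> \<open>Subtracting the expansion of \<open>d\<close> along \<open>B\<close>
          clears \<open>B\<close>, while the value at \<open>e\<close> survives because every
          subtracted chain vanishes there.\<close>
        define c where "c = (\<lambda>x. d x - 1 * (\<Sum>f\<in>B. d f * ?fc f x))"
        have fc: "?fc f \<in> C" "?fc f e = 0" if "f \<in> B" for f
          using contr.fundamental_chain(1)[OF B that] by auto
        have "c \<in> C"
          unfolding c_def by (intro diff_chain sum_chain d fc)
        have "c e = d e"
          by (simp add: c_def fc)
        have "c g = 0" if g: "g \<in> B" for g
        proof -
          have "(\<Sum>f\<in>B. d f * ?fc f g) = (\<Sum>f\<in>B. if f = g then d g else 0)"
            using g by (intro sum.cong) (auto simp: contr.fundamental_chain[OF B])
          then show ?thesis
            using g contr.finite_basis[OF B] by (simp add: c_def)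
        qed
        with \<open>c e = d e\<close> d(2) True show ?thesis
          using scale_chain[OF \<open>c \<in> C\<close>, of "inverse (c e)"]
          by (intro bexI[of _ "\<lambda>x. inverse (c e) * c x"]) auto
      qed
    qed
    ultimately show "e \<notin> B \<and> insert e B \<in> chain_group_bases E C" ..
  next
    assume "e \<notin> B \<and> insert e B \<in> chain_group_bases E C"
    then have eB: "e \<notin> B" and B: "insert e B \<in> chain_group_bases E C" by auto
    show "B \<in> chain_group_bases E ?C"
      unfolding contr.basis_iff
    proof (intro conjI ballI impI)
      show "B \<subseteq> E" using basis_subset[OF B] by simp
    next
      fix c assume "c \<in> ?C" "\<forall>f\<in>B. c f = 0"
      then show "c = (\<lambda>e. 0)" using B unfolding basis_iff by auto
    next
      fix f assume f: "f \<in> B"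
      then obtain c where "c \<in> C" "c f = 1" "\<forall>g\<in>insert e B - {f}. c g = 0"
        using B unfolding basis_iff by blast
      with eB f show "\<exists>c\<in>?C. c f = 1 \<and> (\<forall>g\<in>B - {f}. c g = 0)"
        by (intro bexI[of _ c]) auto
    qed
  qed
qed

end


section \<open>The projection matrix as an average over bases\<close>

locale finite_QU_chain_group = finite_chain_group +
  assumes QU: "QU_chain_group E C"
begin

text \<open>The entry 1 at \<open>f\<close> forces the scalar in front of the primitive chain to
  have norm 1, so all nonzero entries do. Zero entries are covered by
  \<open>inverse 0 = 0\<close>.\<close>

lemma inverse_fundamental_chain:
  assumes B: "B \<in> chain_group_bases E C" and f: "f \<in> B"
  shows "inverse (fundamental_chain B f e) = qcnj (fundamental_chain B f e)"
proof (cases "fundamental_chain B f e = 0")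
  case False
  obtain r c where c: "SH_primitive c" "fundamental_chain B f = (\<lambda>e. r * c e)"
    using QU elementary_fundamental_chain[OF B f] unfolding QU_chain_group_def by blast
  have *: "norm (c x) = 1" if "c x \<noteq> 0" for x
    using c(1) that by (auto simp: SH_primitive_def SH_def)
  have "r * c f = 1"
    using fundamental_chain(2)[OF B f] c(2) by simp
  moreover from this have "norm (c f) = 1"
    by (intro *) auto
  ultimately have "norm r = 1"
    by (metis mult.right_neutral norm_mult norm_one)
  with False c(2) * have "norm (fundamental_chain B f e) = 1"
    by (simp add: norm_mult)
  then show ?thesis by (rule inverse_eq_qcnj)
qed simp

text \<open>For row vectors acting from the left, row \<open>f\<close> of the projection given by
  \<open>B\<close> is the fundamental chain of \<open>f\<close> if \<open>f \<in> B\<close>, and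
  zero otherwise.\<close>

definition basis_average :: "'a \<Rightarrow> 'a \<Rightarrow> quat" where
  "basis_average f e = (\<Sum>B\<in>chain_group_bases E C. if f \<in> B then fundamental_chain B f e else 0)
     /\<^sub>R real (card (chain_group_bases E C))"

lemma basis_average_diag:
  "basis_average e e = of_real (real (card {B \<in> chain_group_bases E C. e \<in> B}) /
     real (card (chain_group_bases E C)))"
proof -
  have "(\<Sum>B\<in>chain_group_bases E C. if e \<in> B then fundamental_chain B e e else 0) =
    (\<Sum>B\<in>chain_group_bases E C. if e \<in> B then 1 else 0)"
    by (intro sum.cong) (auto simp: fundamental_chain)
  also have "\<dots> = of_nat (card {B \<in> chain_group_bases E C. e \<in> B})"
    by (simp add: finite_bases flip: sum.inter_filter)
  finally show ?thesis
    by (simp add: basis_average_def scaleR_conv_of_real divide_inverse mult.commute)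
qed

lemma adjoint_basis_average: "adjoint_matrix basis_average = basis_average"
proof (intro ext)
  fix f e
  let ?T = "\<lambda>B f e. if f \<in> B then fundamental_chain B f e else 0"
  let ?S = "\<lambda>f e. {B \<in> chain_group_bases E C. f \<in> B \<and> fundamental_chain B f e \<noteq> 0}"
  \<comment> \<open>The exchange requires a nonzero entry, so zero entries are dropped before
    reindexing.\<close>
  have restrict: "(\<Sum>B\<in>chain_group_bases E C. ?T B f e) = (\<Sum>B\<in>?S f e. fundamental_chain B f e)"
    for f e
    by (rule sum.mono_neutral_cong_right) (auto simp: finite_bases)
  have "qcnj (\<Sum>B\<in>chain_group_bases E C. ?T B f e) = (\<Sum>B\<in>?S f e. qcnj (fundamental_chain B f e))"
    by (simp only: restrict qcnj_sum)
  also have "\<dots> = (\<Sum>B\<in>?S e f. fundamental_chain B e f)"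
  proof (rule sum.reindex_bij_witness[of _ "\<lambda>B. insert f (B - {e})" "\<lambda>B. insert e (B - {f})"])
    fix B assume "B \<in> ?S f e"
    then have B: "B \<in> chain_group_bases E C" "f \<in> B" "fundamental_chain B f e \<noteq> 0" by auto
    note ex = fundamental_chain_exchange[OF B]
    show "insert f (insert e (B - {f}) - {e}) = B" by (rule ex)
    show "insert e (B - {f}) \<in> ?S e f"
      using ex(1) B(3) by (simp add: ex(2))
    show "fundamental_chain (insert e (B - {f})) e f = qcnj (fundamental_chain B f e)"
      unfolding ex(2) by (rule inverse_fundamental_chain[OF B(1,2)])
  next
    fix B assume "B \<in> ?S e f"
    then have B: "B \<in> chain_group_bases E C" "e \<in> B" "fundamental_chain B e f \<noteq> 0" by auto
    note ex = fundamental_chain_exchange[OF B]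
    show "insert e (insert f (B - {e}) - {f}) = B" by (rule ex)
    show "insert f (B - {e}) \<in> ?S f e"
      using ex(1) B(3) by (simp add: ex(2))
  qed
  finally show "adjoint_matrix basis_average e f = basis_average e f"
    by (simp only: adjoint_matrix_def basis_average_def qcnj_scaleR restrict)
qed

lemma basis_average_chain: "basis_average f \<in> C"
proof -
  let ?r = "of_real (inverse (real (card (chain_group_bases E C))))"
  have "(\<lambda>e. ?r * (\<Sum>B\<in>chain_group_bases E C.
      of_bool (f \<in> B) * (if f \<in> B then fundamental_chain B f else (\<lambda>e. 0)) e)) \<in> C"
    by (intro scale_chain sum_chain) (auto simp: fundamental_chain zero_chain)
  moreover have "basis_average f = (\<lambda>e. ?r * (\<Sum>B\<in>chain_group_bases E C.
      of_bool (f \<in> B) * (if f \<in> B then fundamental_chain B f else (\<lambda>e. 0)) e))"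
    unfolding basis_average_def scaleR_conv_of_real
    by (intro ext arg_cong2[where f = times] sum.cong) auto
  ultimately show ?thesis by simp
qed

lemma basis_average_matrix: "basis_average \<in> matrices E E"
proof -
  have "basis_average f e = 0" if "f \<notin> E" for f e
  proof -
    have "f \<notin> B" if "B \<in> chain_group_bases E C" for B
      using basis_subset[OF that] \<open>f \<notin> E\<close> by blast
    then show ?thesis by (simp add: basis_average_def)
  qed
  then show ?thesis
    using chain_outside[OF basis_average_chain] by (auto simp: matrices_def)
qed

text \<open>By \<open>basis_expansion\<close> the projection of each single basis fixes
  \<open>c\<close>; after swapping the sums, equal values are averaged.\<close>

lemma chain_mult_basis_average:
  assumes c: "c \<in> C"
  shows "row_vec_mult E c basis_average = c"
proof
  fix e
  let ?N = "card (chain_group_bases E C)"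
  have "(\<Sum>f\<in>E. c f * (if f \<in> B then fundamental_chain B f e else 0)) = c e"
    if B: "B \<in> chain_group_bases E C" for B
  proof -
    have "(\<Sum>f\<in>E. c f * (if f \<in> B then fundamental_chain B f e else 0)) =
      (\<Sum>f\<in>B. c f * fundamental_chain B f e)"
      using basis_subset[OF B] by (intro sum.mono_neutral_cong_right) (auto simp: fin)
    then show ?thesis
      using fun_cong[OF basis_expansion[OF B c], of e] by simp
  qed
  moreover have "row_vec_mult E c basis_average e = (\<Sum>B\<in>chain_group_bases E C.
      \<Sum>f\<in>E. c f * (if f \<in> B then fundamental_chain B f e else 0)) /\<^sub>R real ?N"
    unfolding row_vec_mult_def basis_average_def mult_scaleR_right sum_distrib_left
      scaleR_sum_right[symmetric]
    by (subst sum.swap) (rule refl)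
  moreover have "?N \<noteq> 0"
    using bases_nonempty finite_bases by simp
  ultimately show "row_vec_mult E c basis_average e = c e"
    by (simp add: sum_constant_scaleR del: sum_constant)
qed

lemma projection_matrix_eq_basis_average: "projection_matrix E C = basis_average"
  by (intro projection_matrix_eqI basis_average_matrix adjoint_basis_average basis_average_chain
      chain_mult_basis_average)

text \<open>A chain with support inside that of an elementary chain of the contraction also vanishes
  at \<open>e\<close>, so elementarity lifts to \<open>C\<close>. The scalar is nonzero, hence the
  primitive chain vanishes at \<open>e\<close> too.\<close>

lemma contract_QU: "finite_QU_chain_group E {c \<in> C. c e = 0}"
proof -
  let ?C = "{c \<in> C. c e = 0}"
  have cg: "chain_group E ?C"
    using chain_group by (auto simp: chain_group_def)
  have "\<exists>r. \<exists>c'\<in>?C. SH_primitive c' \<and> c = (\<lambda>e. r * c' e)" if c: "elementary ?C c" for c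
  proof -
    have "elementary C c"
      using c unfolding elementary_def chain_support_def by auto
    then obtain r c' where rc: "c' \<in> C" "SH_primitive c'" "c = (\<lambda>e. r * c' e)"
      using QU unfolding QU_chain_group_def by blast
    moreover have "c \<noteq> (\<lambda>e. 0)" "c e = 0"
      using c by (auto simp: elementary_def)
    then have "c' e = 0"
      using rc(3) by auto
    ultimately show ?thesis by blast
  qed
  with cg fin show ?thesis
    by unfold_locales (auto simp: QU_chain_group_def)
qed

text \<open>
  The contraction of \<open>e\<close> is the orthogonal complement in \<open>C\<close> of row \<open>e\<close> of the projection
  matrix, so projecting onto it amounts to taking a Schur complement.
\<close>

lemma projection_matrix_contract:
  defines "P \<equiv> projection_matrix E C"
  assumes nz: "P e e \<noteq> 0"
  shows "projection_matrix E {c \<in> C. c e = 0} = (\<lambda>x y. P x y - P x e * inverse (P e e) * P e y)"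
    (is "_ = ?Q")
proof -
  interpret contr: finite_QU_chain_group E "{c \<in> C. c e = 0}"
    by (rule contract_QU)
  have P: "P = basis_average"
    unfolding P_def by (rule projection_matrix_eq_basis_average)
  have herm: "qcnj (P x y) = P y x" for x y
    using fun_cong[OF fun_cong[OF adjoint_basis_average], of y x]
    by (simp add: P adjoint_matrix_def)
  show ?thesis
  proof (rule contr.projection_matrix_eqI)
    show "?Q \<in> matrices E E"
      using basis_average_matrix by (auto simp: P matrices_def)
    show "adjoint_matrix ?Q = ?Q"
      by (simp add: adjoint_matrix_def qcnj_diff qcnj_mult qcnj_inverse herm mult.assoc)
    show "?Q x \<in> {c \<in> C. c e = 0}" for x
      using nz diff_chain[OF basis_average_chain basis_average_chain,
          of x "P x e * inverse (P e e)" e]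
      by (simp add: P mult.assoc)
    fix c assume c: "c \<in> {c \<in> C. c e = 0}"
    then have fix_c: "(\<Sum>x\<in>E. c x * P x y) = c y" for y
      using fun_cong[OF chain_mult_basis_average, of c y] by (simp add: P row_vec_mult_def)
    \<comment> \<open>The second sum is the value at \<open>e\<close> of \<open>c\<close> times
      \<open>P\<close>, which is \<open>c e = 0\<close>.\<close>
    have "row_vec_mult E c ?Q y = (\<Sum>x\<in>E. c x * P x y) - (\<Sum>x\<in>E. c x * P x e) * inverse (P e e) * P e y"
      for y
      by (simp add: row_vec_mult_def right_diff_distrib sum_subtractf sum_distrib_right mult.assoc)
    with c show "row_vec_mult E c ?Q = c"
      by (auto simp: fix_c)
  qed
qed

end


section \<open>Schur complements\<close>

lemma det_on_cong:
  assumes "\<And>i j. i \<in> S \<Longrightarrow> j \<in> S \<Longrightarrow> A i j = B i j"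
  shows "det_on S A = det_on S B"
  unfolding det_on_def
  by (intro sum.cong refl arg_cong2[where f = times] prod.cong)
    (auto simp: assms permutes_in_image)

lemma det_on_row_linear:
  assumes "finite S" "a \<in> S"
  shows "det_on S (A(a := \<lambda>j. r j + k * s j)) = det_on S (A(a := r)) + k * det_on S (A(a := s))"
proof -
  have *: "(\<Prod>i\<in>S. (A(a := t)) i (p i)) = t (p a) * (\<Prod>i\<in>S - {a}. A i (p i))" for t p
    using assms by (simp add: prod.remove[of S a])
  show ?thesis
    unfolding det_on_def * sum_distrib_left sum.distrib[symmetric]
    by (intro sum.cong refl) (simp add: algebra_simps)
qed

lemma det_on_swap_rows:
  assumes "finite S" "a \<in> S" "b \<in> S" "a \<noteq> b"
  shows "det_on S (\<lambda>i. A (Transposition.transpose a b i)) = - det_on S A"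
proof -
  let ?t = "Transposition.transpose a b"
  have t: "?t permutes S"
    using assms by (intro permutes_swap_id)
  have "det_on S (\<lambda>i. A (?t i)) =
    (\<Sum>p | p permutes S. of_int (sign (p \<circ> ?t)) * (\<Prod>i\<in>S. A (?t i) ((p \<circ> ?t) i)))"
    unfolding det_on_def by (rule sum_permutations_compose_right[OF t])
  also have "\<dots> = (\<Sum>p | p permutes S. - (of_int (sign p) * (\<Prod>i\<in>S. A i (p i))))"
  proof (intro sum.cong refl)
    fix p assume p: "p \<in> {p. p permutes S}"
    have "sign (p \<circ> ?t) = - sign p"
      using p assms
      by (subst sign_compose)
        (auto simp: sign_swap_id permutation_swap_id intro: permutation_permutes[THEN iffD2])
    moreover have "(\<Prod>i\<in>S. A (?t i) ((p \<circ> ?t) i)) = (\<Prod>i\<in>S. A i (p i))"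
      using prod.permute[OF t, of "\<lambda>i. A i (p i)"] by (simp add: comp_def)
    ultimately show "of_int (sign (p \<circ> ?t)) * (\<Prod>i\<in>S. A (?t i) ((p \<circ> ?t) i)) =
        - (of_int (sign p) * (\<Prod>i\<in>S. A i (p i)))"
      by simp
  qed
  finally show ?thesis
    by (simp add: det_on_def sum_negf)
qed

lemma det_on_identical_rows:
  assumes "finite S" "a \<in> S" "b \<in> S" "a \<noteq> b" "A a = A b"
  shows "det_on S A = 0"
proof -
  have "(\<lambda>i. A (Transposition.transpose a b i)) = A"
    using assms(5) by (auto simp: Transposition.transpose_def)
  with det_on_swap_rows[OF assms(1-4), of A] show ?thesis by simp
qed

text \<open>By linearity in row \<open>a\<close> the change is a multiple of a determinant with two
  equal rows.\<close>

lemma det_on_row_add: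
  assumes "finite S" "a \<in> S" "b \<in> S" "a \<noteq> b"
  shows "det_on S (A(a := \<lambda>j. A a j + k * A b j)) = det_on S A"
  using assms det_on_identical_rows[of S a b "A(a := A b)"] det_on_row_linear[of S a A "A a" k "A b"]
  by simp

lemma det_on_zero_row:
  assumes "finite S" "a \<in> S" "\<And>j. j \<in> S \<Longrightarrow> A a j = 0"
  shows "det_on S A = 0"
  unfolding det_on_def
  using assms by (intro sum.neutral) (auto simp: permutes_in_image intro!: prod_zero bexI[of _ a])

text \<open>A permutation moving \<open>a\<close> sends some element of \<open>S\<close> to
  \<open>a\<close> and so picks up a zero from column \<open>a\<close>.\<close>

lemma det_on_zero_column:
  assumes "finite S" "a \<notin> S" "\<And>i. i \<in> S \<Longrightarrow> A i a = 0"
  shows "det_on (insert a S) A = A a a * det_on S A"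
proof -
  let ?g = "\<lambda>p. of_int (sign p) * (\<Prod>i\<in>insert a S. A i (p i))"
  have "det_on (insert a S) A = (\<Sum>p | p permutes S. ?g p)"
    unfolding det_on_def
  proof (rule sum.mono_neutral_right)
    show "finite {p. p permutes insert a S}"
      using assms(1) by (intro finite_permutations) simp
    show "{p. p permutes S} \<subseteq> {p. p permutes insert a S}"
      using permutes_subset by blast
    show "\<forall>p\<in>{p. p permutes insert a S} - {p. p permutes S}. ?g p = 0"
    proof
      fix p assume p: "p \<in> {p. p permutes insert a S} - {p. p permutes S}"
      then have "p a \<noteq> a"
        using permutes_superset[of p "insert a S" S] by auto
      moreover obtain i where i: "p i = a" "i \<in> insert a S"
        using p by (metis DiffD1 insertI1 mem_Collect_eq permutes_def permutes_in_image)
      ultimately have "i \<in> S" by auto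
      with i assms(1,3) show "?g p = 0"
        by (auto intro!: prod_zero bexI[of _ i])
    qed
  qed
  also have "\<dots> = A a a * det_on S A"
    unfolding det_on_def sum_distrib_left
    using assms(1,2) by (intro sum.cong) (auto simp: permutes_not_in)
  finally show ?thesis .
qed

lemma det_on_schur:
  assumes fin: "finite S" and a: "a \<notin> S" and nz: "A a a \<noteq> 0"
  shows "det_on (insert a S) A = A a a * det_on S (\<lambda>i j. A i j - A i a * A a j / A a a)"
proof -
  \<comment> \<open>\<open>U\<close> collects the rows already cleared in column \<open>a\<close>;
    row \<open>a\<close> stays outside it as the pivot row.\<close>
  let ?B = "\<lambda>U i j. if i \<in> U then A i j - A i a * A a j / A a a else A i j"
  have "det_on (insert a S) (?B U) = det_on (insert a S) A" if "U \<subseteq> S" for U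
    using finite_subset[OF that fin] that
  proof (induction U)
    case (insert u U)
    have "?B (insert u U) = (?B U)(u := \<lambda>j. ?B U u j + (- A u a / A a a) * ?B U a j)"
      using insert a by (auto simp: fun_eq_iff)
    moreover have "det_on (insert a S) ((?B U)(u := \<lambda>j. ?B U u j + (- A u a / A a a) * ?B U a j)) =
        det_on (insert a S) (?B U)"
      using insert.prems a fin by (intro det_on_row_add) auto
    ultimately have "det_on (insert a S) (?B (insert u U)) = det_on (insert a S) (?B U)"
      by (simp only:)
    with insert show ?case by simp
  qed simp
  from this[of S] have "det_on (insert a S) A = det_on (insert a S) (?B S)"
    by simp
  also have "\<dots> = ?B S a a * det_on S (?B S)"
    using nz by (intro det_on_zero_column fin a) auto
  also have "\<dots> = A a a * det_on S (\<lambda>i j. A i j - A i a * A a j / A a a)"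
    using a by (auto intro!: det_on_cong)
  finally show ?thesis .
qed

section \<open>From complex to quaternion Schur complements\<close>

lemma phi_diff: "phi (p - q) = phi p - phi q"
  by (simp add: vec_eq_iff forall_2 phi_def vector_2 minus_quat_def complex_eq_iff)

lemma phi_mult: "phi (p * q) $ i $ j = phi p $ i $ 1 * phi q $ 1 $ j + phi p $ i $ 2 * phi q $ 2 $ j"
  using exhaust_2[of i] exhaust_2[of j]
  by (auto simp: phi_def vector_2 times_quat_def complex_eq_iff algebra_simps)

lemma phi_scaleR: "phi (r *\<^sub>R p) $ i $ j = of_real r * phi p $ i $ j"
  using exhaust_2[of i] exhaust_2[of j]
  by (auto simp: phi_def vector_2 scaleR_quat_def complex_eq_iff)

lemma phi_of_real: "phi (of_real r) = mat (of_real r)"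
  by (simp add: vec_eq_iff forall_2 phi_def vector_2 of_real_def scaleR_quat_def one_quat_def
      mat_def complex_eq_iff)

lemma delta_cong:
  assumes "\<And>x y. x \<in> F \<Longrightarrow> y \<in> F \<Longrightarrow> D x y = D' x y"
  shows "delta F D = delta F D'"
  unfolding delta_def
  by (intro arg_cong[where f = "\<lambda>z. sqrt (cmod z)"] det_on_cong) (auto simp: z2_def assms)

lemma delta_zero_row:
  assumes "finite F" "e \<in> F" "\<And>y. D e y = 0"
  shows "delta F D = 0"
proof -
  have "det_on (F \<times> UNIV) (z2 (\<lambda>e f. phi (D e f))) = 0"
    using assms phi_of_real[of 0]
    by (intro det_on_zero_row[of _ "(e, 1)"]) (auto simp: z2_def mat_def)
  then show ?thesis by (simp add: delta_def)
qed

text \<open>A real pivot is central and becomes a scalar block under \<open>phi\<close>, so two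
  complex Schur steps, at \<open>(e, 1)\<close> and \<open>(e, 2)\<close>, eliminate it. Each gives
  a factor \<open>p\<close>, and the square root in \<open>delta\<close> leaves one
  \<open>\<bar>p\<bar>\<close>.\<close>

lemma delta_schur:
  fixes p :: real
  assumes fin: "finite F" and e: "e \<notin> F" and p: "D e e = of_real p" "p \<noteq> 0"
  shows "delta (insert e F) D = \<bar>p\<bar> * delta F (\<lambda>x y. D x y - D x e * inverse (D e e) * D e y)"
proof -
  define A where "A = z2 (\<lambda>x y. phi (D x y))"
  define A1 where "A1 = (\<lambda>x y. A x y - A x (e, 1) * A (e, 1) y / of_real p)"
  define A2 where "A2 = (\<lambda>x y. A1 x y - A1 x (e, 2) * A1 (e, 2) y / of_real p)"
  have diag: "A (e, 1) (e, 1) = of_real p" "A (e, 1) (e, 2) = 0"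
    "A (e, 2) (e, 1) = 0" "A (e, 2) (e, 2) = of_real p"
    by (simp_all add: A_def z2_def p phi_of_real mat_def)
  have "insert e F \<times> (UNIV :: 2 set) = insert (e, 1) (insert (e, 2) (F \<times> UNIV))"
    by (auto simp: UNIV_2)
  then have "det_on (insert e F \<times> UNIV) A = of_real p * det_on (insert (e, 2) (F \<times> UNIV)) A1"
    using det_on_schur[of "insert (e, 2) (F \<times> UNIV)" "(e, 1)" A] fin e p(2)
    by (simp add: diag A1_def)
  \<comment> \<open>The off-diagonal zeros of the block keep the second pivot equal to
    \<open>p\<close>.\<close>
  also have "det_on (insert (e, 2) (F \<times> UNIV)) A1 = of_real p * det_on (F \<times> UNIV) A2"
    using det_on_schur[of "F \<times> UNIV" "(e, 2)" A1] fin e p(2)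
    by (simp add: A2_def) (simp add: A1_def diag)
  also have "A2 = z2 (\<lambda>x y. phi (D x y - D x e * inverse (D e e) * D e y))"
  proof (intro ext, clarify)
    fix x y and i j :: 2
    have "inverse (D e e) = inverse p *\<^sub>R 1"
      by (simp add: p(1) of_real_inverse flip: of_real_def)
    then have "D x e * inverse (D e e) * D e y = inverse p *\<^sub>R (D x e * D e y)"
      by simp
    then have "phi (D x y - D x e * inverse (D e e) * D e y) $ i $ j =
        phi (D x y) $ i $ j - of_real (inverse p) * phi (D x e * D e y) $ i $ j"
      by (simp only: phi_diff phi_scaleR vector_minus_component)
    \<comment> \<open>The same zeros keep row and column \<open>(e, 2)\<close> unchanged in the
      first step, so by \<open>phi_mult\<close> the two corrections add up to an entry of
      \<open>phi (D x e * D e y)\<close> divided by \<open>p\<close>.\<close>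
    moreover have "A2 (x, i) (y, j) = A (x, i) (y, j) - A (x, i) (e, 1) * A (e, 1) (y, j) / of_real p -
        A (x, i) (e, 2) * A (e, 2) (y, j) / of_real p"
      by (simp add: A2_def A1_def diag)
    ultimately show "A2 (x, i) (y, j) = z2 (\<lambda>x y. phi (D x y - D x e * inverse (D e e) * D e y)) (x, i) (y, j)"
      using p(2) by (simp only: A_def z2_def prod.case phi_mult) (simp add: field_simps)
  qed
  finally show ?thesis
    by (simp add: delta_def A_def norm_mult real_sqrt_mult)
qed


section \<open>Principal submatrices of the projection matrix\<close>

text \<open>\<open>C\<close> varies in the induction, since splitting off \<open>e\<close> replaces
  it by the contraction. The pivot gives the share of bases through \<open>e\<close>, the induction
  hypothesis the share among these that contain \<open>F\<close>.\<close>

lemma delta_projection_matrix: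
  assumes "finite F" "finite_QU_chain_group E C"
  shows "delta F (projection_matrix E C) =
    real (card {B \<in> chain_group_bases E C. F \<subseteq> B}) / real (card (chain_group_bases E C))"
  using assms
proof (induction F arbitrary: C)
  case empty
  interpret finite_QU_chain_group E C by (rule empty.prems)
  show ?case
    using bases_nonempty finite_bases by (simp add: delta_empty)
next
  case (insert e F)
  interpret finite_QU_chain_group E C by (rule insert.prems)
  let ?P = "projection_matrix E C"
  let ?N = "card (chain_group_bases E C)" and ?n = "card {B \<in> chain_group_bases E C. e \<in> B}"
  have diag: "?P e e = of_real (real ?n / real ?N)"
    by (simp only: projection_matrix_eq_basis_average basis_average_diag)
  have N: "?N \<noteq> 0"
    using bases_nonempty finite_bases by simp
  show ?case
  proof (cases "\<exists>B\<in>chain_group_bases E C. e \<in> B")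
    \<comment> \<open>Row \<open>e\<close> of the projection is zero and no basis contains
      \<open>insert e F\<close>, so both sides vanish.\<close>
    case False
    then have "?P e y = 0" for y
      by (auto simp: projection_matrix_eq_basis_average basis_average_def intro!: sum.neutral)
    then have "delta (insert e F) ?P = 0"
      using insert.hyps by (intro delta_zero_row[of _ e]) auto
    moreover have "{B \<in> chain_group_bases E C. insert e F \<subseteq> B} = {}"
      using False by auto
    ultimately show ?thesis by (simp only: card.empty of_nat_0 div_0)
  next
    case True
    then obtain B0 where B0: "B0 \<in> chain_group_bases E C" "e \<in> B0" by blast
    let ?C = "{c \<in> C. c e = 0}"
    have n: "?n \<noteq> 0"
      using B0 finite_bases by auto
    then have P: "real ?n / real ?N \<noteq> 0"
      using N by simp
    have "?P e e \<noteq> 0"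
      using P unfolding diag of_real_eq_0_iff .
    have contract: "B \<in> chain_group_bases E ?C \<longleftrightarrow> e \<notin> B \<and> insert e B \<in> chain_group_bases E C" for B
      using bases_contract[of "fundamental_chain B0 e" e] fundamental_chain[OF B0] by simp
    \<comment> \<open>Inserting \<open>e\<close> matches bases of the contraction with bases through
      \<open>e\<close>; \<open>G = {}\<close> will give the denominator and \<open>G = F\<close> the
      numerator.\<close>
    have card_eq: "card {B \<in> chain_group_bases E ?C. G \<subseteq> B} =
        card {B \<in> chain_group_bases E C. insert e G \<subseteq> B}" if "e \<notin> G" for G
      by (rule bij_betw_same_card[of "insert e"], rule bij_betw_byWitness[of _ "\<lambda>B. B - {e}"])
        (use that in \<open>auto simp: contract insert_absorb\<close>)
    have "delta (insert e F) ?P = \<bar>real ?n / real ?N\<bar> * delta F (projection_matrix E ?C)"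
      by (simp only: projection_matrix_contract[OF \<open>?P e e \<noteq> 0\<close>]
          delta_schur[where D = ?P, OF insert.hyps diag P])
    also have "delta F (projection_matrix E ?C) =
        real (card {B \<in> chain_group_bases E C. insert e F \<subseteq> B}) / real ?n"
      using insert.IH[OF contract_QU[of e]] card_eq[of "{}"] card_eq[of F] insert.hyps by simp
    finally show ?thesis
      using n by simp
  qed
qed

theorem theorem5p7:
  fixes E F :: "'e set" and C :: "('e \<Rightarrow> quat) set"
  assumes "finite E"
    and "QU_chain_group E C"
    and "F \<subseteq> E"
  shows "delta F (submatrix_on (projection_matrix E C) F F) =
    real (card {B. B \<subseteq> E \<and> B \<in> chain_group_bases E C \<and> F \<subseteq> B}) /
    real (card {B. B \<subseteq> E \<and> B \<in> chain_group_bases E C})"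
proof -
  interpret finite_QU_chain_group E C
    using assms by unfold_locales (auto simp: QU_chain_group_def)
  have "delta F (submatrix_on (projection_matrix E C) F F) = delta F (projection_matrix E C)"
    by (rule delta_cong) (simp add: submatrix_on_def)
  moreover have "{B. B \<subseteq> E \<and> B \<in> chain_group_bases E C \<and> F \<subseteq> B} = {B \<in> chain_group_bases E C. F \<subseteq> B}"
    "{B. B \<subseteq> E \<and> B \<in> chain_group_bases E C} = chain_group_bases E C"
    using basis_subset by auto
  ultimately show ?thesis
    using delta_projection_matrix[OF finite_subset[OF assms(3,1)] finite_QU_chain_group_axioms]
    by simp
qed

end
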